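(* Let $k,n\ge1$ be integers and let $\mathcal{V}\subseteq\{0,1,\dots,k-1\}^n\subseteq\mathbb{Q}^n$ be a finite point set. For each $1\le i\le n$ let $\prec_i$ be an elimination order with respect to $x_i$ on the monomials of $\mathbb{Q}[x_1,\dots,x_n]$. If $\mathcal{V}$ is not extremal, then there exist $i,j\in[n]$ such that $\mathrm{Sm}(I(\mathcal{V}))$ with respect to $\prec_i$ differs from $\mathrm{Sm}(I(\mathcal{V}))$ with respect to $\prec_j$.
   Context: $I(\mathcal{V})\subseteq\mathbb{Q}[x_1,\dots,x_n]$ is the ideal of polynomials vanishing on all points of $\mathcal{V}$. A term order is a total order on monomials with $1$ minimal and compatible with multiplication by monomials; the leading monomial of a nonzero polynomial is its largest monomial with nonzero coefficient; a standard monomial of an ideal $I$ is a monomial that is not the leading monomial of any nonzero element of $I$, and $\mathrm{Sm}(I)$ is their set. A term order is an elimination order with respect to $x_i$ if $x_i$ is larger than every monomial of $\mathbb{Q}[x_1,\dots,x_{i-1},x_{i+1},\dots,x_n]$. For an ordering $x_{i_1}\succ\dots\succ x_{i_n}$ of the variables, the lexicographic order is: $x^{\mathbf w}\prec x^{\mathbf u}$ iff for the smallest $j$ with $w_{i_j}\ne u_{i_j}$ one has $w_{i_j}<u_{i_j}$. $\mathcal{V}$ is extremal if $\mathrm{Sm}(I(\mathcal{V}))$ is the same for every lexicographic order. *)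

theory Defs
  imports Complex_Main "HOL-Library.Poly_Mapping"
begin

text \<open>
  The finite index type \<open>'n\<close> names the variables, so the number of variables is \<open>CARD('n)\<close>.
  A monomial is its exponent vector; multiplication of monomials is addition of exponent vectors,
  and the monomial 1 is \<open>0\<close>.
\<close>

type_synonym 'n monomial = "'n \<Rightarrow>\<^sub>0 nat"
type_synonym 'n polynomial = "('n \<Rightarrow>\<^sub>0 nat) \<Rightarrow>\<^sub>0 rat"

definition poly_eval :: "'n::finite polynomial \<Rightarrow> ('n \<Rightarrow> rat) \<Rightarrow> rat" where
  "poly_eval f x =
    (\<Sum>m\<in>Poly_Mapping.keys f.
      Poly_Mapping.lookup f m * (\<Prod>i\<in>UNIV. x i ^ Poly_Mapping.lookup m i))"

definition vanishing_ideal :: "('n::finite \<Rightarrow> rat) set \<Rightarrow> 'n polynomial set" where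
  "vanishing_ideal V = {f. \<forall>x\<in>V. poly_eval f x = 0}"

text \<open>Orders on monomials are given by their strict part.\<close>

definition term_order :: "('n monomial \<Rightarrow> 'n monomial \<Rightarrow> bool) \<Rightarrow> bool" where
  "term_order prec \<longleftrightarrow>
    irreflp prec \<and> transp prec \<and> totalp prec \<and>
    (\<forall>u. u \<noteq> 0 \<longrightarrow> prec 0 u) \<and>
    (\<forall>u v w. prec u v \<longrightarrow> prec (u + w) (v + w))"

text \<open>Meaningful only for nonzero \<open>f\<close> and total orders \<open>prec\<close>.\<close>

definition leading_monomial ::
    "('n monomial \<Rightarrow> 'n monomial \<Rightarrow> bool) \<Rightarrow> 'n polynomial \<Rightarrow> 'n monomial" where
  "leading_monomial prec f =
    (THE m. m \<in> Poly_Mapping.keys f \<and> (\<forall>v\<in>Poly_Mapping.keys f. v \<noteq> m \<longrightarrow> prec v m))"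

definition standard_monomials ::
    "('n monomial \<Rightarrow> 'n monomial \<Rightarrow> bool) \<Rightarrow> 'n polynomial set \<Rightarrow> 'n monomial set" where
  "standard_monomials prec I = {m. \<not> (\<exists>f\<in>I. f \<noteq> 0 \<and> leading_monomial prec f = m)}"

definition elimination_order ::
    "'n \<Rightarrow> ('n monomial \<Rightarrow> 'n monomial \<Rightarrow> bool) \<Rightarrow> bool" where
  "elimination_order i prec \<longleftrightarrow>
    term_order prec \<and>
    (\<forall>m. Poly_Mapping.lookup m i = 0 \<longrightarrow> prec m (Poly_Mapping.single i 1))"

text \<open>An ordering of the variables is a list of all of them without repetition, largest first.\<close>

definition variable_ordering :: "'n list \<Rightarrow> bool" where
  "variable_ordering xs \<longleftrightarrow> distinct xs \<and> set xs = UNIV"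

definition lex_order :: "'n list \<Rightarrow> 'n monomial \<Rightarrow> 'n monomial \<Rightarrow> bool" where
  "lex_order xs w u \<longleftrightarrow>
    (\<exists>j<length xs.
      (\<forall>l<j. Poly_Mapping.lookup w (xs ! l) = Poly_Mapping.lookup u (xs ! l)) \<and>
      Poly_Mapping.lookup w (xs ! j) < Poly_Mapping.lookup u (xs ! j))"

definition extremal :: "('n::finite \<Rightarrow> rat) set \<Rightarrow> bool" where
  "extremal V \<longleftrightarrow>
    (\<forall>xs ys. variable_ordering xs \<longrightarrow> variable_ordering ys \<longrightarrow>
      standard_monomials (lex_order xs) (vanishing_ideal V) =
      standard_monomials (lex_order ys) (vanishing_ideal V))"

end

theory Submission
  imports Defs "HOL-Library.Ramsey"
begin

text \<open>
  Suppose all the orders \<open>prec i\<close> give the same set \<open>S\<close> of standard monomials. Modulo the vanishing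
  ideal, a monomial \<open>m\<close> has a unique representation by monomials in \<open>S\<close>, and reduction
  with respect to \<open>prec i\<close> shows that the \<open>x\<^sub>i\<close>-exponents occurring in it are at most that of \<open>m\<close>.
  As this holds for every \<open>i\<close>, only divisors of \<open>m\<close> occur. Hence each \<open>m\<close> outside \<open>S\<close> is the
  leading monomial of the same element of the ideal for all term orders at once, so that the
  standard monomials of every term order lie in \<open>S\<close>, and then coincide with \<open>S\<close>. Only the
  linear structure of the ideal matters.
\<close>

section \<open>Term orders\<close>

lemma term_order_irrefl: "term_order prec \<Longrightarrow> \<not> prec u u"
  by (auto simp: term_order_def irreflp_def)

lemma term_order_trans: "term_order prec \<Longrightarrow> prec u v \<Longrightarrow> prec v w \<Longrightarrow> prec u w"
  unfolding term_order_def by (meson transpD)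

lemma term_order_total: "term_order prec \<Longrightarrow> u \<noteq> v \<Longrightarrow> prec u v \<or> prec v u"
  by (auto simp: term_order_def totalp_on_def)

lemma term_order_add: "term_order prec \<Longrightarrow> prec u v \<Longrightarrow> prec (u + w) (v + w)"
  by (auto simp: term_order_def)

text \<open>The truncated difference \<open>m - s\<close> is the true quotient because
  \<open>s\<close> divides \<open>m\<close>. Either it is 1, or it lies above 1 and multiplying by
  \<open>s\<close> gives the claim.\<close>

lemma term_order_divides:
  assumes "term_order prec"
    and le: "\<And>i. Poly_Mapping.lookup s i \<le> Poly_Mapping.lookup m i"
  shows "s = m \<or> prec s m"
proof (cases "m - s = 0")
  case True
  have "m = s + (m - s)"
    by (rule poly_mapping_eqI) (simp add: lookup_add lookup_minus le)
  then show ?thesis using True by (metis add.right_neutral)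
next
  case False
  then have "prec (0 + s) (m - s + s)"
    using assms(1) by (intro term_order_add[OF assms(1)]) (simp add: term_order_def)
  moreover have "m - s + s = m"
    by (rule poly_mapping_eqI) (simp add: lookup_add lookup_minus le)
  ultimately show ?thesis by simp
qed

text \<open>Ramsey's theorem replaces Dickson's lemma: if \<open>u\<close> precedes \<open>v\<close>, then some exponent
  of \<open>u\<close> is smaller than that of \<open>v\<close>.\<close>

lemma term_order_wf:
  fixes prec :: "'n::finite monomial \<Rightarrow> 'n monomial \<Rightarrow> bool"
  assumes T: "term_order prec"
  shows "wf {(u, v). prec u v}"
proof -
  obtain n :: nat and e :: "nat \<Rightarrow> 'n" where e: "e ` {i. i < n} = UNIV"
    using finite_imp_nat_seg_image_inj_on[OF finite_UNIV] by metis
  \<comment> \<open>\<open>R i\<close> is the part of the order along which the exponent of the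
    variable \<open>e i\<close> drops, so it is well-founded. The variables are numbered by
    \<open>e\<close> because \<open>disj_wf\<close> indexes its relations by naturals.\<close>
  define R where "R i = {(u, v). prec u v} \<inter>
    measure (\<lambda>m :: 'n monomial. Poly_Mapping.lookup m (e i))" for i
  have trans: "trans {(u, v). prec u v}"
    using term_order_trans[OF T] by (auto intro!: transI)
  have "\<exists>i<n. (u, v) \<in> R i" if "prec u v" for u v
  proof -
    have "\<not> (v = u \<or> prec v u)"
      using that term_order_irrefl[OF T] term_order_trans[OF T] by metis
    then obtain j where "Poly_Mapping.lookup u j < Poly_Mapping.lookup v j"
      using term_order_divides[OF T, of v u] by (meson not_le)
    moreover obtain i where "i < n" "j = e i" using e by blast
    ultimately show ?thesis using that by (auto simp: R_def)
  qed
  then have "{(u, v). prec u v} = (\<Union>i<n. R i)" by (fastforce simp: R_def)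
  moreover have "wf (R i)" for i
    unfolding R_def by (rule wf_Int2) simp
  ultimately have "disj_wf {(u, v). prec u v}"
    unfolding disj_wf_def by (intro exI[of _ R] exI[of _ n]) auto
  \<comment> \<open>Ramsey's theorem enters here: a transitive relation that is a finite union of
    well-founded relations is well-founded.\<close>
  with trans show ?thesis by (rule trans_disj_wf_implies_wf)
qed

text \<open>If the exponent \<open>a\<close> of the variable \<open>i\<close> in \<open>m\<close>
  were smaller than in \<open>s\<close>, split \<open>m\<close> into the power with exponent
  \<open>a\<close> and a cofactor \<open>m'\<close> free of that variable. Elimination puts
  \<open>m'\<close> below the variable, hence \<open>m\<close> below its power with exponent
  \<open>Suc a\<close>. That power divides \<open>s\<close>, so \<open>m\<close> would precede
  \<open>s\<close>.\<close>

lemma elimination_order_lookup_le: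
  assumes E: "elimination_order i prec" and p: "prec s m"
  shows "Poly_Mapping.lookup s i \<le> Poly_Mapping.lookup m i"
proof (rule ccontr)
  assume "\<not> ?thesis"
  then have less: "Poly_Mapping.lookup m i < Poly_Mapping.lookup s i" by simp
  have T: "term_order prec" using E by (simp add: elimination_order_def)
  define a where "a = Poly_Mapping.lookup m i"
  define m' where "m' = m - Poly_Mapping.single i a"
  have m: "m = m' + Poly_Mapping.single i a"
    by (rule poly_mapping_eqI)
      (simp add: m'_def a_def lookup_add lookup_minus lookup_single when_def)
  have "Poly_Mapping.lookup m' i = 0"
    by (simp add: m'_def a_def lookup_minus)
  then have "prec m' (Poly_Mapping.single i 1)"
    using E by (simp add: elimination_order_def)
  from term_order_add[OF T this, of "Poly_Mapping.single i a"]
  have 1: "prec m (Poly_Mapping.single i (Suc a))"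
    by (subst m, simp flip: single_add)
  have "Poly_Mapping.single i (Suc a) = s \<or> prec (Poly_Mapping.single i (Suc a)) s"
    using less by (intro term_order_divides[OF T])
      (auto simp: a_def lookup_single when_def)
  then have "prec m s" using 1 term_order_trans[OF T] by blast
  then show False using p term_order_trans[OF T] term_order_irrefl[OF T] by blast
qed

section \<open>Lexicographic orders\<close>

lemma term_order_lex_order:
  fixes xs :: "'n list"
  assumes "variable_ordering xs"
  shows "term_order (lex_order xs)"
  unfolding term_order_def
proof (intro conjI allI impI)
  \<comment> \<open>Totality and the minimality of 1 both rest on this: every variable occurs in
    \<open>xs\<close>, so distinct monomials differ at some position, and the least such position
    decides.\<close>
  have first_difference: "\<exists>j<length xs.
      (\<forall>l<j. Poly_Mapping.lookup u (xs ! l) = Poly_Mapping.lookup v (xs ! l)) \<and>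
      Poly_Mapping.lookup u (xs ! j) \<noteq> Poly_Mapping.lookup v (xs ! j)"
    if neq: "u \<noteq> v" for u v :: "'n monomial"
  proof -
    let ?P = "\<lambda>j. j < length xs \<and>
      Poly_Mapping.lookup u (xs ! j) \<noteq> Poly_Mapping.lookup v (xs ! j)"
    obtain i where "Poly_Mapping.lookup u i \<noteq> Poly_Mapping.lookup v i"
      using neq by (metis poly_mapping_eqI)
    moreover obtain j where "j < length xs" "xs ! j = i"
      using assms by (metis UNIV_I in_set_conv_nth variable_ordering_def)
    ultimately have "?P j" by simp
    then have "?P (LEAST j. ?P j)" by (rule LeastI)
    moreover have "\<not> ?P l" if "l < (LEAST j. ?P j)" for l
      using not_less_Least[OF that] .
    ultimately show ?thesis by (meson less_trans)
  qed
  show "irreflp (lex_order xs)"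
    by (auto simp: irreflp_def lex_order_def)
  show "transp (lex_order xs)"
  proof (rule transpI)
    fix u v w assume "lex_order xs u v" "lex_order xs v w"
    then obtain i j where
      i: "i < length xs" "\<forall>l<i. Poly_Mapping.lookup u (xs ! l) = Poly_Mapping.lookup v (xs ! l)"
        "Poly_Mapping.lookup u (xs ! i) < Poly_Mapping.lookup v (xs ! i)" and
      j: "j < length xs" "\<forall>l<j. Poly_Mapping.lookup v (xs ! l) = Poly_Mapping.lookup w (xs ! l)"
        "Poly_Mapping.lookup v (xs ! j) < Poly_Mapping.lookup w (xs ! j)"
      by (auto simp: lex_order_def)
    show "lex_order xs u w"
      unfolding lex_order_def
    \<comment> \<open>The first difference between \<open>u\<close> and \<open>w\<close> is at the
      earlier of the two deciding positions; if these coincide, the two strict inequalities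
      compose.\<close>
    proof (intro exI[of _ "min i j"] conjI)
      show "Poly_Mapping.lookup u (xs ! min i j) < Poly_Mapping.lookup w (xs ! min i j)"
        using i j by (cases i j rule: linorder_cases) (auto simp: min_def)
    qed (use i j in auto)
  qed
  show "totalp (lex_order xs)"
  proof (rule totalpI)
    fix u v :: "'n monomial" assume "u \<noteq> v"
    from first_difference[OF this] show "lex_order xs u v \<or> lex_order xs v u"
      unfolding lex_order_def by (metis nat_neq_iff)
  qed
  show "lex_order xs 0 u" if "u \<noteq> 0" for u
    using first_difference[of 0 u] that by (auto simp: lex_order_def)
  show "lex_order xs (u + w) (v + w)" if "lex_order xs u v" for u v w
    using that by (auto simp: lex_order_def lookup_add)
qed

section \<open>Leading monomials\<close>

lemma leading_monomial_eqI:
  assumes T: "term_order prec"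
    and "m \<in> Poly_Mapping.keys f" "\<And>v. v \<in> Poly_Mapping.keys f \<Longrightarrow> v \<noteq> m \<Longrightarrow> prec v m"
  shows "leading_monomial prec f = m"
  unfolding leading_monomial_def
proof (rule the_equality)
  fix u assume "u \<in> Poly_Mapping.keys f \<and> (\<forall>v\<in>Poly_Mapping.keys f. v \<noteq> u \<longrightarrow> prec v u)"
  then show "u = m"
    using assms(2,3) term_order_trans[OF T, of u m u] term_order_irrefl[OF T, of u] by metis
qed (use assms in blast)

text \<open>The support of a nonzero polynomial is finite and nonempty, so by induction it has a
  greatest element, and the definite description in \<open>leading_monomial\<close> denotes
  it.\<close>

lemma leading_monomial_greatest:
  assumes T: "term_order prec" and "f \<noteq> 0"
  shows "leading_monomial prec f \<in> Poly_Mapping.keys f"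
    and "v \<in> Poly_Mapping.keys f \<Longrightarrow> v \<noteq> leading_monomial prec f
      \<Longrightarrow> prec v (leading_monomial prec f)"
proof -
  have "\<exists>m\<in>A. \<forall>v\<in>A. v \<noteq> m \<longrightarrow> prec v m" if "finite A" "A \<noteq> {}" for A
    using that
  proof (induction A rule: finite_ne_induct)
    case (insert a A)
    then obtain m where m: "m \<in> A" "\<forall>v\<in>A. v \<noteq> m \<longrightarrow> prec v m" by blast
    then consider "prec a m" | "prec m a"
      using term_order_total[OF T] insert.hyps by metis
    then show ?case
    proof cases
      case 1
      then show ?thesis using m by (intro bexI[of _ m]) auto
    next
      case 2
      then have "prec v a" if "v \<in> A" for v
        using that m term_order_trans[OF T, of v m a] by (cases "v = m") auto
      then show ?thesis by (intro bexI[of _ a]) auto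
    qed
  qed simp
  from this[of "Poly_Mapping.keys f"] obtain m where
    m: "m \<in> Poly_Mapping.keys f" "\<And>v. v \<in> Poly_Mapping.keys f \<Longrightarrow> v \<noteq> m \<Longrightarrow> prec v m"
    using \<open>f \<noteq> 0\<close> by auto
  then have "leading_monomial prec f = m" by (rule leading_monomial_eqI[OF T])
  with m show "leading_monomial prec f \<in> Poly_Mapping.keys f"
    and "v \<in> Poly_Mapping.keys f \<Longrightarrow> v \<noteq> leading_monomial prec f
      \<Longrightarrow> prec v (leading_monomial prec f)"
    by auto
qed

section \<open>Linear subspaces and normal forms\<close>

definition scale :: "rat \<Rightarrow> 'n polynomial \<Rightarrow> 'n polynomial" where
  "scale c = Poly_Mapping.map ((*) c)"

lemma lookup_scale [simp]: "Poly_Mapping.lookup (scale c f) m = c * Poly_Mapping.lookup f m"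
  by (simp add: scale_def Poly_Mapping.map.rep_eq when_def)

lemma keys_scale_subset: "Poly_Mapping.keys (scale c f) \<subseteq> Poly_Mapping.keys f"
  by (auto simp: in_keys_iff)

text \<open>This is the structure of the ideal that reduction uses: normal forms arise from linear
  combinations of its elements, with recursion along the order in place of multiplication by
  monomials.\<close>

definition linear_subspace :: "'n polynomial set \<Rightarrow> bool" where
  "linear_subspace I \<longleftrightarrow>
    0 \<in> I \<and> (\<forall>f\<in>I. \<forall>g\<in>I. f + g \<in> I) \<and> (\<forall>c. \<forall>f\<in>I. scale c f \<in> I)"

lemma linear_subspace_diff:
  assumes "linear_subspace I" "f \<in> I" "g \<in> I"
  shows "f - g \<in> I"
proof -
  have "f - g = f + scale (- 1) g"
    by (rule poly_mapping_eqI) (simp add: lookup_add lookup_minus)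
  then show ?thesis using assms by (metis linear_subspace_def)
qed

lemma linear_subspace_sum:
  assumes "linear_subspace I" "\<And>a. a \<in> A \<Longrightarrow> f a \<in> I"
  shows "sum f A \<in> I"
  using assms(2)
  by (induction A rule: infinite_finite_induct) (use assms(1) in \<open>auto simp: linear_subspace_def\<close>)

lemma linear_subspace_vanishing_ideal: "linear_subspace (vanishing_ideal V)"
proof -
  \<comment> \<open>Extending the sum to any finite superset of the support lets polynomials with
    different supports be evaluated over one index set.\<close>
  have sup: "poly_eval f x = (\<Sum>m\<in>A. Poly_Mapping.lookup f m *
      (\<Prod>i\<in>UNIV. x i ^ Poly_Mapping.lookup m i))"
    if "finite A" "Poly_Mapping.keys f \<subseteq> A" for A and f :: "'a polynomial" and x
    unfolding poly_eval_def using that by (intro sum.mono_neutral_left) (auto simp: in_keys_iff)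
  have add: "poly_eval (f + g) x = poly_eval f x + poly_eval g x" for f g :: "'a polynomial" and x
    using keys_add[of f g] sup[of "Poly_Mapping.keys f \<union> Poly_Mapping.keys g"]
    by (simp add: lookup_add distrib_right sum.distrib)
  have scale: "poly_eval (scale c f) x = c * poly_eval f x" for c and f :: "'a polynomial" and x
    using keys_scale_subset[of c f] sup[of "Poly_Mapping.keys f"]
    by (simp add: sum_distrib_left mult.assoc)
  show ?thesis
    unfolding linear_subspace_def vanishing_ideal_def
    by (auto simp: add scale) (simp add: poly_eval_def)
qed

section \<open>Existence and uniqueness of normal forms\<close>

lemma standard_combination_eq_0:
  assumes "term_order prec" "f \<in> I" "Poly_Mapping.keys f \<subseteq> standard_monomials prec I"
  shows "f = 0"
  using assms leading_monomial_greatest(1)[OF assms(1), of f]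
  by (auto simp: standard_monomials_def)

text \<open>By well-founded induction: a standard monomial is its own normal form, and any other is
  congruent to a combination of smaller monomials, whose normal forms are combined linearly. The
  bound \<open>s = m \<or> prec s m\<close> is kept because elimination orders turn it into a bound
  on exponents.\<close>

lemma normal_form_exists:
  fixes prec :: "'n::finite monomial \<Rightarrow> 'n monomial \<Rightarrow> bool"
  assumes T: "term_order prec" and I: "linear_subspace I"
  shows "\<exists>g. Poly_Mapping.keys g \<subseteq> {s \<in> standard_monomials prec I. s = m \<or> prec s m} \<and>
    Poly_Mapping.single m 1 - g \<in> I"
proof (induction m rule: wf_induct_rule[OF term_order_wf[OF T]])
  case (1 m)
  let ?N = "\<lambda>m. {s \<in> standard_monomials prec I. s = m \<or> prec s m}"
  show ?case
  proof (cases "m \<in> standard_monomials prec I")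
    case True
    then show ?thesis
      using I by (intro exI[of _ "Poly_Mapping.single m 1"]) (auto simp: linear_subspace_def)
  next
    case False
    then obtain f where f: "f \<in> I" "f \<noteq> 0" "leading_monomial prec f = m"
      by (auto simp: standard_monomials_def)
    define c where "c = Poly_Mapping.lookup f m"
    \<comment> \<open>One reduction step: dividing \<open>f\<close> by its leading coefficient
      cancels \<open>m\<close>, so \<open>h\<close> is congruent to \<open>m\<close> and contains
      only smaller monomials.\<close>
    define h where "h = Poly_Mapping.single m 1 - scale (1 / c) f"
    have c: "c \<noteq> 0"
      using leading_monomial_greatest(1)[OF T f(2)] f(3) by (simp add: c_def in_keys_iff)
    have h: "prec v m" if "v \<in> Poly_Mapping.keys h" for v
    proof -
      have "v \<noteq> m"
        using that c by (auto simp: h_def in_keys_iff lookup_minus c_def)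
      moreover from this have "v \<in> Poly_Mapping.keys f"
        using that by (auto simp: h_def in_keys_iff lookup_minus lookup_single)
      ultimately show ?thesis using leading_monomial_greatest(2)[OF T f(2)] f(3) by simp
    qed
    then have "\<forall>v\<in>Poly_Mapping.keys h. \<exists>g. Poly_Mapping.keys g \<subseteq> ?N v \<and>
        Poly_Mapping.single v 1 - g \<in> I"
      using 1 by blast
    from bchoice[OF this] obtain G where
      G: "\<And>v. v \<in> Poly_Mapping.keys h \<Longrightarrow> Poly_Mapping.keys (G v) \<subseteq> ?N v"
      "\<And>v. v \<in> Poly_Mapping.keys h \<Longrightarrow> Poly_Mapping.single v 1 - G v \<in> I"
      by blast
    define g where "g = (\<Sum>v\<in>Poly_Mapping.keys h. scale (Poly_Mapping.lookup h v) (G v))"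
    have "Poly_Mapping.keys g \<subseteq>
        (\<Union>v\<in>Poly_Mapping.keys h. Poly_Mapping.keys (scale (Poly_Mapping.lookup h v) (G v)))"
      unfolding g_def by (rule keys_sum)
    also have "\<dots> \<subseteq> (\<Union>v\<in>Poly_Mapping.keys h. ?N v)"
      using G(1) keys_scale_subset by (intro UN_mono) blast+
    also have "\<dots> \<subseteq> ?N m"
      using h term_order_trans[OF T] by blast
    finally have keys: "Poly_Mapping.keys g \<subseteq> ?N m" .
    have "h = (\<Sum>v\<in>Poly_Mapping.keys h. Poly_Mapping.single v (Poly_Mapping.lookup h v))"
      by (rule poly_mapping_eqI)
        (auto simp: lookup_sum lookup_single when_def in_keys_iff)
    then have "h - g = (\<Sum>v\<in>Poly_Mapping.keys h.
        Poly_Mapping.single v (Poly_Mapping.lookup h v) - scale (Poly_Mapping.lookup h v) (G v))"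
      by (simp add: g_def sum_subtractf)
    also have "\<dots> = (\<Sum>v\<in>Poly_Mapping.keys h.
        scale (Poly_Mapping.lookup h v) (Poly_Mapping.single v 1 - G v))"
      by (intro sum.cong refl poly_mapping_eqI)
        (simp add: lookup_minus lookup_single when_def algebra_simps)
    also have "\<dots> \<in> I"
      using G(2) I by (intro linear_subspace_sum) (auto simp: linear_subspace_def)
    finally have "scale (1 / c) f + (h - g) \<in> I"
      using I f(1) by (simp add: linear_subspace_def)
    then have "Poly_Mapping.single m 1 - g \<in> I"
      by (simp add: h_def)
    with keys show ?thesis by blast
  qed
qed

text \<open>The difference of two normal forms lies in \<open>I\<close> and is supported on standard
  monomials, so it vanishes.\<close>

lemma normal_form_unique:
  assumes T: "term_order prec" and I: "linear_subspace I"
    and "Poly_Mapping.keys g \<subseteq> standard_monomials prec I" "f - g \<in> I"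
    and "Poly_Mapping.keys h \<subseteq> standard_monomials prec I" "f - h \<in> I"
  shows "g = h"
proof -
  have "(f - h) - (f - g) \<in> I" using I assms(6,4) by (rule linear_subspace_diff)
  then have "g - h \<in> I" by simp
  moreover have "Poly_Mapping.keys (g - h) \<subseteq> standard_monomials prec I"
    using keys_diff[of g h] assms by blast
  ultimately have "g - h = 0" using standard_combination_eq_0[OF T] by blast
  then show ?thesis by simp
qed

section \<open>From elimination orders to all term orders\<close>

lemma standard_monomials_eq_of_elimination_orders:
  fixes prec :: "'n::finite \<Rightarrow> 'n monomial \<Rightarrow> 'n monomial \<Rightarrow> bool"
  assumes I: "linear_subspace I"
    and E: "\<And>i. elimination_order i (prec i)"
    and S: "\<And>i. standard_monomials (prec i) I = S"
    and T: "term_order lt"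
  shows "standard_monomials lt I = S"
proof
  have Ti: "term_order (prec i)" for i
    using E by (simp add: elimination_order_def)
  show sub: "standard_monomials lt I \<subseteq> S"
  proof
    fix m assume m: "m \<in> standard_monomials lt I"
    show "m \<in> S"
    proof (rule ccontr)
      assume "m \<notin> S"
      have "\<forall>i. \<exists>g. Poly_Mapping.keys g \<subseteq> {s \<in> S. s = m \<or> prec i s m} \<and>
          Poly_Mapping.single m 1 - g \<in> I"
        using normal_form_exists[OF Ti I, unfolded S] by (intro allI)
      from choice[OF this] obtain G where G: "\<And>i. Poly_Mapping.keys (G i) \<subseteq> {s \<in> S. s = m \<or> prec i s m}"
        "\<And>i. Poly_Mapping.single m 1 - G i \<in> I"
        by blast
      \<comment> \<open>Any index serves: the orders \<open>prec i\<close> share \<open>S\<close>,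
        so by uniqueness all the normal forms \<open>G i\<close> agree.\<close>
      define g where "g = G undefined"
      have "G i = g" for i
        unfolding g_def
        by (rule normal_form_unique[OF Ti I, where f = "Poly_Mapping.single m 1"])
          (use G S in blast)+
      then have g: "Poly_Mapping.keys g \<subseteq> {s \<in> S. s = m \<or> prec i s m}"
        and f: "Poly_Mapping.single m 1 - g \<in> I" for i
        using G by metis+
      \<comment> \<open>As \<open>s\<close> is in \<open>S\<close> and \<open>m\<close> is not,
        \<open>s\<close> strictly precedes \<open>m\<close> in every \<open>prec i\<close>. This
        bounds every exponent, so \<open>s\<close> is a proper divisor of \<open>m\<close> and lies
        below it in \<open>lt\<close> too.\<close>
      have lt: "s \<noteq> m \<and> lt s m" if s: "s \<in> Poly_Mapping.keys g" for s
      proof -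
        have "s \<noteq> m" using s g \<open>m \<notin> S\<close> by blast
        moreover have "Poly_Mapping.lookup s i \<le> Poly_Mapping.lookup m i" for i
          using s g[of i] \<open>s \<noteq> m\<close> elimination_order_lookup_le[OF E] by blast
        ultimately show ?thesis using term_order_divides[OF T] by blast
      qed
      have "m \<notin> Poly_Mapping.keys g" using lt by blast
      then have key: "m \<in> Poly_Mapping.keys (Poly_Mapping.single m 1 - g)"
        by (simp add: in_keys_iff lookup_minus)
      have "leading_monomial lt (Poly_Mapping.single m 1 - g) = m"
        using key by (rule leading_monomial_eqI[OF T])
          (use lt keys_diff[of "Poly_Mapping.single m (1::rat)" g] in auto)
      moreover have "Poly_Mapping.single m 1 - g \<noteq> 0" using key by force
      ultimately show False
        using f m by (auto simp: standard_monomials_def)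
    qed
  qed
  show "S \<subseteq> standard_monomials lt I"
  proof
    fix m assume m: "m \<in> S"
    obtain g where g: "Poly_Mapping.keys g \<subseteq> standard_monomials lt I"
      "Poly_Mapping.single m 1 - g \<in> I"
      using normal_form_exists[OF T I, of m] by blast
    \<comment> \<open>By the inclusion \<open>sub\<close>, the \<open>lt\<close>-normal form
      \<open>g\<close> is also supported on \<open>S\<close>. Since \<open>m\<close> in
      \<open>S\<close> is its own normal form for each \<open>prec i\<close>, uniqueness identifies
      the two.\<close>
    have "Poly_Mapping.single m 1 = g"
      by (rule normal_form_unique[OF Ti I, where f = "Poly_Mapping.single m 1"])
        (use m g sub S I in \<open>auto simp: linear_subspace_def\<close>)
    then show "m \<in> standard_monomials lt I" using g(1) by auto
  qed
qed

theorem theorem5: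
  fixes k :: nat
    and V :: "('n::finite \<Rightarrow> rat) set"
    and prec :: "'n \<Rightarrow> 'n monomial \<Rightarrow> 'n monomial \<Rightarrow> bool"
  assumes "k \<ge> 1"
    and "finite V"
    and "V \<subseteq> {x. \<forall>i. x i \<in> of_nat ` {0..k - 1}}"
    and "\<And>i. elimination_order i (prec i)"
    and "\<not> extremal V"
  shows "\<exists>i j. standard_monomials (prec i) (vanishing_ideal V)
             \<noteq> standard_monomials (prec j) (vanishing_ideal V)"
proof (rule ccontr)
  assume "\<not> ?thesis"
  \<comment> \<open>The arbitrary index \<open>undefined\<close> names the common set of standard
    monomials, with which every lexicographic order is then compared.\<close>
  then have S: "standard_monomials (prec i) (vanishing_ideal V) =
      standard_monomials (prec undefined) (vanishing_ideal V)" for i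
    by blast
  have "standard_monomials (lex_order xs) (vanishing_ideal V) =
      standard_monomials (prec undefined) (vanishing_ideal V)" if "variable_ordering xs" for xs
    by (rule standard_monomials_eq_of_elimination_orders
        [OF linear_subspace_vanishing_ideal assms(4) S term_order_lex_order[OF that]])
  then have "extremal V" by (simp add: extremal_def)
  with assms(5) show False by contradiction
qed

end
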